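(* For any $n,k\in\mathbb{N}$ (with $n,k\ge 1$) and any $t\in(-k,-k+1)$, $$\lim_{\substack{z\to t\\ \Im z>0}}\Im f_n(z)=\pi\,\frac{\frac{(-1)^n}{n!}(k-1)_n\log|t|-\log|G_n(t+1)|}{t^n\left((\log|t|)^2+\pi^2\right)},$$ where $f_n(z)=\dfrac{\log G_n(z+1)}{z^n\operatorname{Log} z}$ for $z\in\mathbb{C}\setminus(-\infty,0]$.
   Context: $G_n$ ($n\ge1$) is the (Barnes) multiple Gamma function of order $n$: with $G_0(z)=z$, the $G_n$ are the unique meromorphic functions on $\mathbb{C}$ such that (1) $G_n(z+1)=G_{n-1}(z)G_n(z)$, (2) $G_n(1)=1$, (3) on $x\ge 1$, $G_n$ is infinitely differentiable and $\frac{d^{n+1}}{dx^{n+1}}\log G_n(x)\ge 0$. In particular $G_1=\Gamma$ is Euler's Gamma function and $G_2$ is the Barnes $G$-function. $G_n$ is positive on $(0,\infty)$ and its only zeros or poles are at $0,-1,-2,\ldots$. $\log G_n$ denotes the holomorphic branch on $\mathbb{C}\setminus(-\infty,0]$ that is real on $(0,\infty)$, and $\operatorname{Log}$ is the principal logarithm. $(a)_n=a(a+1)\cdots(a+n-1)$ is the Pochhammer symbol (so $(0)_n=0$). The singularity of $f_n$ at $z=1$ is removable. *)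

theory Defs
  imports "HOL-Complex_Analysis.Complex_Analysis"
begin

text \<open>
  Meromorphic functions on the plane are total functions that are nicely meromorphic: they agree
  with their limit at every non-pole, and the value at a pole is (by convention) 0. Because of
  that convention, identities between them are required off a discrete closed set only: for
  instance \<open>Gamma (z + 1) = z * Gamma z\<close> fails at 0 for the totalized function.
  The logarithm of the order-n function on the ray from 1 to infinity presupposes that the
  function is positive there; this is spelled out. Smoothness on that ray excludes poles there,
  since the pole value 0 would make the function discontinuous.
\<close>

definition multiple_Gamma_functions :: "(nat \<Rightarrow> complex \<Rightarrow> complex) \<Rightarrow> bool" where
  "multiple_Gamma_functions G \<longleftrightarrow>
     G 0 = (\<lambda>z. z) \<and>
     (\<forall>n\<ge>1.
        G n nicely_meromorphic_on UNIV \<and>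
        (\<forall>\<^sub>\<approx>z\<in>UNIV. G n (z + 1) = G (n - 1) z * G n z) \<and>
        G n 1 = 1 \<and>
        (\<forall>x::real\<ge>1.
           G n (of_real x) \<in> \<real> \<and> Re (G n (of_real x)) > 0 \<and>
           (\<forall>j. ((deriv ^^ j) (\<lambda>y::real. Re (G n (of_real y)))) differentiable (at x)) \<and>
           (deriv ^^ (n + 1)) (\<lambda>y::real. ln (Re (G n (of_real y)))) x \<ge> 0))"

definition real_log_branch :: "(complex \<Rightarrow> complex) \<Rightarrow> (complex \<Rightarrow> complex) \<Rightarrow> bool" where
  "real_log_branch F L \<longleftrightarrow>
     L holomorphic_on (- \<real>\<^sub>\<le>\<^sub>0) \<and>
     (\<forall>z \<in> - \<real>\<^sub>\<le>\<^sub>0. exp (L z) = F z) \<and>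
     (\<forall>x::real>0. L (of_real x) \<in> \<real>)"

text \<open>
  Here \<open>L\<close> is the logarithm of the multiple Gamma function of order \<open>n\<close>. At the removable
  singularity \<open>z = 1\<close> the quotient takes the default value 0 of a division by zero; this is
  irrelevant for the boundary behaviour at the negative axis.
\<close>

definition f_quot :: "(complex \<Rightarrow> complex) \<Rightarrow> nat \<Rightarrow> complex \<Rightarrow> complex" where
  "f_quot L n z = L (z + 1) / (z ^ n * Ln z)"

end

theory Submission
  imports Defs
begin

text \<open>
  Near \<open>t\<close> the denominator of \<open>f_quot\<close> is explicit: \<open>Ln z\<close> tends to \<open>ln \<bar>t\<bar> + \<i> * pi\<close> from above.
  Everything therefore rests on the boundary value of \<open>log G_n\<close> at \<open>w = t + 1\<close>. Its real part
  must be \<open>ln \<bar>G_n w\<bar>\<close>, so the content is the value of its imaginary part.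

  The functional equation \<open>G_n (z + 1) = G_(n-1) z * G_n z\<close> says that the forward difference
  \<open>L (z + 1) - L z\<close> of the real logarithm of \<open>G_n\<close> is the real logarithm of \<open>G_(n-1)\<close>
  (\<open>real_log_branch_difference\<close>). After \<open>n\<close> differences one arrives at a real logarithm of
  the identity, that is, at \<open>Ln\<close>, whose imaginary part tends to \<open>pi\<close> at the negative axis from above. So, if
  \<open>pi * c n j\<close> is the imaginary part of the boundary value on the interval from \<open>- j\<close> to \<open>- j + 1\<close>,
  then \<open>c (n + 1) j = c (n + 1) (j + 1) + c n (j + 1)\<close>, with \<open>c 0 j = 1\<close> for \<open>j \<ge> 1\<close> and
  \<open>c n 0 = 0\<close> for \<open>n \<ge> 1\<close>, since the logarithms are real on the positive axis.
  This is Pascal's rule for \<open>c n j = (- j) gchoose n\<close>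
  (\<open>multiple_Gamma_log_limit_from_above\<close>), which with \<open>j = k - 1\<close> is the Pochhammer
  expression of the theorem.
\<close>

section \<open>Limits of nicely meromorphic functions\<close>

lemma upper_half_plane_filter_nontrivial:
  "at (of_real w) within {z. Im z > 0} \<noteq> bot"
proof -
  have "\<exists>z\<in>{z. Im z > 0}. z \<noteq> of_real w \<and> dist z (of_real w) < e" if "e > 0" for e
    by (rule bexI[of _ "of_real w + of_real (e / 2) * \<i>"])
       (use that in \<open>auto simp: dist_norm norm_mult complex_eq_iff\<close>)
  then have "(of_real w :: complex) islimpt {z. Im z > 0}"
    by (auto simp: islimpt_approachable)
  then show ?thesis
    by (simp add: trivial_limit_within)
qed

lemma filterlim_shift_upper_half_plane:
  "filterlim (\<lambda>z. z + 1) (at (of_real (t + 1)) within {z. Im z > 0})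
     (at (of_real t) within {z. Im z > 0})"
  unfolding filterlim_at by (auto intro!: tendsto_eq_intros simp: eventually_at_filter)

text \<open>
  Near a pole the norm tends to infinity along every approach, so a finite limit along some set
  \<open>S\<close> already rules out a pole. This turns both an identity valid off a discrete set and a limit
  from the upper half-plane into a statement about the value at the point.
\<close>

lemma nicely_meromorphic_value_eq_limit:
  assumes "f nicely_meromorphic_on A" "z \<in> A"
    and lim: "(f \<longlongrightarrow> l) (at z within S)"
    and nontriv: "at z within S \<noteq> bot"
  shows "f z = l"
proof -
  have "\<not> is_pole f z"
  proof
    assume "is_pole f z"
    then have "filterlim f at_infinity (at z within S)"
      unfolding is_pole_def by (rule filterlim_mono) (auto intro: at_le)
    with lim nontriv show False
      using not_tendsto_and_filterlim_at_infinity by blast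
  qed
  with assms(1,2) have "f \<midarrow>z\<rightarrow> f z"
    by (auto simp: nicely_meromorphic_on_def)
  then have "(f \<longlongrightarrow> f z) (at z within S)"
    by (rule tendsto_mono[rotated]) (auto intro: at_le)
  with lim nontriv show ?thesis
    using tendsto_unique by blast
qed

section \<open>Logarithms on the slit plane\<close>

lemma nicely_meromorphic_multiple_Gamma:
  assumes "multiple_Gamma_functions G"
  shows "G n nicely_meromorphic_on UNIV"
proof (cases "n = 0")
  case True
  have "(\<lambda>z. z) nicely_meromorphic_on UNIV"
    by (intro analytic_on_imp_nicely_meromorphic_on analytic_intros)
  then show ?thesis
    using assms True by (simp add: multiple_Gamma_functions_def)
next
  case False
  then show ?thesis
    using assms by (auto simp: multiple_Gamma_functions_def)
qed

lemma shift_slit_plane: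
  fixes z :: complex
  assumes "z \<in> - \<real>\<^sub>\<le>\<^sub>0"
  shows "z + 1 \<in> - \<real>\<^sub>\<le>\<^sub>0"
  using assms by (auto simp: complex_nonpos_Reals_iff)

text \<open>
  Taking logarithms turns the multiplicative functional equation into a difference equation, so
  a logarithm of one \<open>G n\<close> yields logarithms of all functions of lower order. The functional equation holds
  only off a discrete set, but the exponential of the difference is continuous and hence
  determines the values of \<open>G m\<close> at the exceptional points as well.
\<close>

lemma real_log_branch_difference:
  assumes G: "multiple_Gamma_functions G"
    and L: "real_log_branch (G (Suc m)) L"
  shows "real_log_branch (G m) (\<lambda>z. L (z + 1) - L z)"
proof -
  have hol: "L holomorphic_on (- \<real>\<^sub>\<le>\<^sub>0)"
    and expL: "\<And>z. z \<in> - \<real>\<^sub>\<le>\<^sub>0 \<Longrightarrow> exp (L z) = G (Suc m) z"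
    and realL: "\<And>x::real. x > 0 \<Longrightarrow> L (of_real x) \<in> \<real>"
    using L by (auto simp: real_log_branch_def)
  have "(L \<circ> (\<lambda>z. z + 1)) holomorphic_on (- \<real>\<^sub>\<le>\<^sub>0)"
    by (rule holomorphic_on_compose_gen[OF _ hol])
       (use shift_slit_plane in \<open>auto intro!: holomorphic_intros\<close>)
  then have hol': "(\<lambda>z. L (z + 1) - L z) holomorphic_on (- \<real>\<^sub>\<le>\<^sub>0)"
    by (intro holomorphic_intros hol) (simp add: o_def)
  have "exp (L (z + 1) - L z) = G m z" if z: "z \<in> - \<real>\<^sub>\<le>\<^sub>0" for z
  proof -
    have op: "open (- \<real>\<^sub>\<le>\<^sub>0 :: complex set)"
      by (simp add: open_Compl)
    have "\<forall>\<^sub>\<approx>z\<in>UNIV. G (Suc m) (z + 1) = G m z * G (Suc m) z"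
      using G unfolding multiple_Gamma_functions_def by (metis diff_Suc_1 le_add1 plus_1_eq_Suc)
    then have "\<forall>\<^sub>F y in at z. G (Suc m) (y + 1) = G m y * G (Suc m) y"
      by (rule eventually_cosparse_imp_eventually_at) auto
    moreover have "\<forall>\<^sub>F y in at z. y \<in> - \<real>\<^sub>\<le>\<^sub>0"
      using op z by (rule eventually_at_in_open')
    ultimately have ev: "\<forall>\<^sub>F y in at z. exp (L (y + 1) - L y) = G m y"
    proof eventually_elim
      case (elim y)
      have "exp (L (y + 1)) = G m y * exp (L y)"
        using elim expL[of y] expL[OF shift_slit_plane, of y] by simp
      then show ?case
        by (simp add: exp_diff field_simps)
    qed
    have "isCont (\<lambda>z. L (z + 1) - L z) z"
      using holomorphic_on_imp_continuous_on[OF hol'] op z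
      by (simp add: continuous_on_eq_continuous_at)
    then have "((\<lambda>y. exp (L (y + 1) - L y)) \<longlongrightarrow> exp (L (z + 1) - L z)) (at z)"
      by (intro tendsto_exp) (simp add: isCont_def)
    then have "(G m \<longlongrightarrow> exp (L (z + 1) - L z)) (at z)"
      using ev by (rule Lim_transform_eventually)
    then show ?thesis
      using nicely_meromorphic_value_eq_limit[OF nicely_meromorphic_multiple_Gamma[OF G]]
      by (metis UNIV_I at_neq_bot)
  qed
  moreover have "L (of_real x + 1) - L (of_real x) \<in> \<real>" if "x > 0" for x :: real
    using realL[of "x + 1"] realL[of x] that by simp
  ultimately show ?thesis
    using hol' unfolding real_log_branch_def by blast
qed

lemma connected_slit_plane: "connected (- \<real>\<^sub>\<le>\<^sub>0 :: complex set)"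
proof -
  have "(\<real>\<^sub>\<le>\<^sub>0 :: complex set) = of_real ` {..0}"
    by (auto simp: nonpos_Reals_def)
  then show ?thesis
    using starlike_slotted_complex_plane_left[of 0] by (simp add: starlike_imp_connected)
qed

text \<open>
  Two logarithms of the same function differ by integer multiples of \<open>2 * pi * \<i>\<close>; by connectedness
  the multiple is constant, and reality at 1 makes it zero.
\<close>

lemma real_log_branch_identity:
  assumes L: "real_log_branch (\<lambda>z. z) L" and z: "z \<in> - \<real>\<^sub>\<le>\<^sub>0"
  shows "L z = Ln z"
proof -
  have exp_diff_1: "exp (L y - Ln y) = 1" if "y \<in> - \<real>\<^sub>\<le>\<^sub>0" for y
  proof -
    have "exp (L y) = y" and "y \<noteq> 0"
      using L that by (auto simp: real_log_branch_def)
    then show ?thesis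
      by (simp add: exp_diff)
  qed
  have "(\<lambda>y. L y - Ln y) constant_on (- \<real>\<^sub>\<le>\<^sub>0)"
  proof (rule continuous_discrete_range_constant[OF connected_slit_plane])
    show "continuous_on (- \<real>\<^sub>\<le>\<^sub>0) (\<lambda>y. L y - Ln y)"
    proof (intro continuous_on_diff continuous_on_Ln)
      show "continuous_on (- \<real>\<^sub>\<le>\<^sub>0) L"
        using L unfolding real_log_branch_def by (blast intro: holomorphic_on_imp_continuous_on)
    qed auto
    show "\<exists>e>0. \<forall>v. v \<in> - \<real>\<^sub>\<le>\<^sub>0 \<and> L v - Ln v \<noteq> L u - Ln u \<longrightarrow>
            e \<le> norm ((L v - Ln v) - (L u - Ln u))" if u: "u \<in> - \<real>\<^sub>\<le>\<^sub>0" for u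
    proof (intro exI[of _ "2 * pi"] conjI allI impI)
      fix v
      assume v: "v \<in> - \<real>\<^sub>\<le>\<^sub>0 \<and> L v - Ln v \<noteq> L u - Ln u"
      then have "\<not> \<bar>Im (L v - Ln v) - Im (L u - Ln u)\<bar> < 2 * pi"
        using exp_complex_eqI exp_diff_1 u by metis
      then show "2 * pi \<le> norm ((L v - Ln v) - (L u - Ln u))"
        using abs_Im_le_cmod[of "(L v - Ln v) - (L u - Ln u)"] by simp
    qed simp
  qed
  moreover have "(1::complex) \<in> - \<real>\<^sub>\<le>\<^sub>0"
    by simp
  moreover have "L 1 - Ln 1 = 0"
  proof -
    have "L (of_real 1) \<in> \<real>"
      using L by (auto simp: real_log_branch_def simp del: of_real_1)
    then have "Im (L 1) = 0"
      by (auto simp: complex_is_Real_iff)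
    then show ?thesis
      using exp_diff_1[of 1] exp_complex_eqI[of "L 1" 0] by simp
  qed
  ultimately have "L z - Ln z = 0"
    using z unfolding constant_on_def by metis
  then show ?thesis
    by simp
qed

section \<open>Boundary values from the upper half-plane\<close>

lemma Ln_limit_from_above:
  assumes "w < 0"
  shows "(Ln \<longlongrightarrow> Complex (ln \<bar>w\<bar>) pi) (at (of_real w) within {z. Im z > 0})"
proof -
  \<comment> \<open>Above the cut \<open>Ln\<close> continues analytically across it as \<open>Ln (- z) + \<i> * pi\<close>.\<close>
  have "((\<lambda>z. Ln (- z) + \<i> * pi) \<longlongrightarrow> Ln (- of_real w) + \<i> * pi)
          (at (of_real w) within {z. Im z > 0})"
    using assms by (intro tendsto_intros) (auto simp: complex_nonpos_Reals_iff)
  moreover have "\<forall>\<^sub>F z in at (of_real w) within {z. Im z > 0}. Ln (- z) + \<i> * pi = Ln z"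
  proof -
    have "Ln (- z) + \<i> * pi = Ln z" if "Im z > 0" for z
      using that Ln_minus[of z] by (cases "z = 0") auto
    then show ?thesis
      by (simp add: eventually_at_filter)
  qed
  moreover have "Ln (- of_real w) + \<i> * pi = Complex (ln \<bar>w\<bar>) pi"
    using assms Ln_of_real[of "- w"] by (simp add: complex_eq_iff)
  ultimately show ?thesis
    by (simp only: Lim_transform_eventually)
qed

text \<open>
  The induction runs over the order \<open>n\<close>, and for fixed order over the intervals, from right to left:
  \<open>L z = L (z + 1) - (L (z + 1) - L z)\<close> expresses the boundary value at \<open>w\<close> by that of the same
  logarithm one unit to the right and that of the logarithm of order one lower at \<open>w\<close>
  itself. The pair \<open>n = 0\<close>, \<open>j = 0\<close> has to be excluded: there \<open>Ln\<close> is real on the positive axis,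
  whereas the binomial coefficient is 1.
\<close>

lemma multiple_Gamma_log_limit_from_above:
  assumes G: "multiple_Gamma_functions G"
    and L: "real_log_branch (G n) L"
    and w: "w \<in> {- real j <..< - real j + 1}"
    and nj: "n \<ge> 1 \<or> j \<ge> 1"
  shows "\<exists>r. (L \<longlongrightarrow> Complex r (pi * ((- real j) gchoose n)))
              (at (of_real w) within {z. Im z > 0})"
  using L w nj
proof (induction n arbitrary: L j w)
  case 0
  have "real_log_branch (\<lambda>z. z) L"
    using G 0 by (simp add: multiple_Gamma_functions_def)
  then have "L z = Ln z" if "Im z > 0" for z
    using that by (intro real_log_branch_identity) (auto simp: complex_nonpos_Reals_iff)
  then have "\<forall>\<^sub>F z in at (of_real w) within {z. Im z > 0}. Ln z = L z"
    by (simp add: eventually_at_filter)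
  moreover have "w < 0"
    using 0 by auto
  ultimately have "(L \<longlongrightarrow> Complex (ln \<bar>w\<bar>) pi) (at (of_real w) within {z. Im z > 0})"
    using Ln_limit_from_above by (blast intro: Lim_transform_eventually)
  then show ?case
    by auto
next
  case (Suc n)
  note L = Suc.prems(1) and IH_order = Suc.IH
  have diff: "real_log_branch (G n) (\<lambda>z. L (z + 1) - L z)"
    by (rule real_log_branch_difference[OF G L])
  show ?case
    using Suc.prems(2)
  proof (induction j arbitrary: w)
    case 0
    then have "w > 0"
      by simp
    have "continuous_on (- \<real>\<^sub>\<le>\<^sub>0) L" and "L (of_real w) \<in> \<real>"
      using L \<open>w > 0\<close> by (auto simp: real_log_branch_def intro: holomorphic_on_imp_continuous_on)
    then have "isCont L (of_real w)"
      using \<open>w > 0\<close> by (subst (asm) continuous_on_eq_continuous_at) (auto simp: open_Compl)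
    then have "(L \<longlongrightarrow> L (of_real w)) (at (of_real w) within {z. Im z > 0})"
      unfolding isCont_def by (rule tendsto_mono[rotated]) (auto intro: at_le)
    moreover have "L (of_real w) = Complex (Re (L (of_real w))) (pi * ((- real 0) gchoose Suc n))"
      using \<open>L (of_real w) \<in> \<real>\<close> by (simp add: complex_eq_iff complex_is_Real_iff)
    ultimately show ?case
      by metis
  next
    case (Suc j)
    have w1: "w + 1 \<in> {- real j <..< - real j + 1}"
      using Suc.prems by auto
    obtain r where "(L \<longlongrightarrow> Complex r (pi * ((- real j) gchoose Suc n)))
        (at (of_real (w + 1)) within {z. Im z > 0})"
      using Suc.IH[OF w1] by blast
    then have shifted: "((\<lambda>z. L (z + 1)) \<longlongrightarrow> Complex r (pi * ((- real j) gchoose Suc n)))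
        (at (of_real w) within {z. Im z > 0})"
      by (rule filterlim_compose[OF _ filterlim_shift_upper_half_plane])
    obtain s where "((\<lambda>z. L (z + 1) - L z) \<longlongrightarrow> Complex s (pi * ((- real (Suc j)) gchoose n)))
        (at (of_real w) within {z. Im z > 0})"
      using IH_order[OF diff Suc.prems disjI2] by (metis le_add1 plus_1_eq_Suc)
    from tendsto_diff[OF shifted this]
    have "(L \<longlongrightarrow> Complex r (pi * ((- real j) gchoose Suc n))
              - Complex s (pi * ((- real (Suc j)) gchoose n)))
            (at (of_real w) within {z. Im z > 0})"
      by simp
    moreover have "(- real j) gchoose Suc n
        = ((- real (Suc j)) gchoose n) + ((- real (Suc j)) gchoose Suc n)"
      using gbinomial_Suc_Suc[of "- real (Suc j)" n] by simp
    then have "Complex r (pi * ((- real j) gchoose Suc n))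
        - Complex s (pi * ((- real (Suc j)) gchoose n))
        = Complex (r - s) (pi * ((- real (Suc j)) gchoose Suc n))"
      by (simp add: complex_eq_iff algebra_simps)
    ultimately show ?case
      by metis
  qed
qed

text \<open>
  A logarithm with a boundary value at \<open>w\<close> shows that \<open>w\<close> is neither a zero nor a pole of \<open>F\<close>:
  the boundary value exponentiates to \<open>F w\<close>.
\<close>

lemma real_part_of_log_limit:
  assumes F: "F nicely_meromorphic_on UNIV"
    and L: "real_log_branch F L"
    and lim: "(L \<longlongrightarrow> l) (at (of_real w) within {z. Im z > 0})"
  shows "Re l = ln (norm (F (of_real w)))"
proof -
  have "((\<lambda>z. exp (L z)) \<longlongrightarrow> exp l) (at (of_real w) within {z. Im z > 0})"
    by (intro tendsto_exp lim)
  moreover have "\<forall>\<^sub>F z in at (of_real w) within {z. Im z > 0}. exp (L z) = F z"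
    using L by (auto simp: real_log_branch_def eventually_at_filter complex_nonpos_Reals_iff)
  ultimately have "(F \<longlongrightarrow> exp l) (at (of_real w) within {z. Im z > 0})"
    by (rule Lim_transform_eventually)
  then have "F (of_real w) = exp l"
    using nicely_meromorphic_value_eq_limit[OF F] upper_half_plane_filter_nontrivial by blast
  then show ?thesis
    by simp
qed

theorem proposition2:
  fixes G :: "nat \<Rightarrow> complex \<Rightarrow> complex" and logGn :: "complex \<Rightarrow> complex"
    and n k :: nat and t :: real
  assumes "multiple_Gamma_functions G"
    and "real_log_branch (G n) logGn"
    and "n \<ge> 1" and "k \<ge> 1"
    and "t \<in> {- real k <..< - real k + 1}"
  shows "((\<lambda>z. Im (f_quot logGn n z)) \<longlongrightarrow>
           pi * (((-1) ^ n / fact n * pochhammer (real k - 1) n * ln \<bar>t\<bar>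
                   - ln (norm (G n (of_real t + 1))))
                 / (t ^ n * ((ln \<bar>t\<bar>)\<^sup>2 + pi\<^sup>2))))
         (at (of_real t) within {z. Im z > 0})"
proof -
  define \<theta> where "\<theta> = (-1) ^ n / fact n * pochhammer (real k - 1) n"
  define A where "A = ln (norm (G n (of_real t + 1)))"
  have "t < 0"
    using assms(4,5) by auto
  have \<theta>: "(- real (k - 1)) gchoose n = \<theta>"
    using assms(4) by (simp add: \<theta>_def gbinomial_pochhammer of_nat_diff)
  have "t + 1 \<in> {- real (k - 1) <..< - real (k - 1) + 1}"
    using assms(4,5) by (auto simp: of_nat_diff)
  then obtain r where r: "(logGn \<longlongrightarrow> Complex r (pi * \<theta>))
      (at (of_real (t + 1)) within {z. Im z > 0})"
    using multiple_Gamma_log_limit_from_above[OF assms(1,2)] assms(3) \<theta> by metis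
  have "r = A"
    using real_part_of_log_limit[OF nicely_meromorphic_multiple_Gamma[OF assms(1)] assms(2) r]
    by (simp add: A_def)
  then have "((\<lambda>z. logGn (z + 1)) \<longlongrightarrow> Complex A (pi * \<theta>))
      (at (of_real t) within {z. Im z > 0})"
    using filterlim_compose[OF r filterlim_shift_upper_half_plane] by simp
  then have "((\<lambda>z. f_quot logGn n z) \<longlongrightarrow>
      Complex A (pi * \<theta>) / (of_real t ^ n * Complex (ln \<bar>t\<bar>) pi))
      (at (of_real t) within {z. Im z > 0})"
    unfolding f_quot_def using \<open>t < 0\<close>
    by (intro tendsto_intros Ln_limit_from_above) (auto simp: complex_eq_iff)
  then have "((\<lambda>z. Im (f_quot logGn n z)) \<longlongrightarrow>
      Im (Complex A (pi * \<theta>) / (of_real t ^ n * Complex (ln \<bar>t\<bar>) pi)))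
      (at (of_real t) within {z. Im z > 0})"
    by (rule tendsto_Im)
  also have "Complex A (pi * \<theta>) / (of_real t ^ n * Complex (ln \<bar>t\<bar>) pi)
      = (Complex A (pi * \<theta>) / Complex (ln \<bar>t\<bar>) pi) / of_real (t ^ n)"
    by (simp add: mult.commute)
  also have "Im \<dots> = (pi * \<theta> * ln \<bar>t\<bar> - A * pi) / ((ln \<bar>t\<bar>)\<^sup>2 + pi\<^sup>2) / t ^ n"
    by (simp only: Im_divide_of_real) (simp add: Im_divide)
  also have "\<dots> = pi * ((\<theta> * ln \<bar>t\<bar> - A) / (t ^ n * ((ln \<bar>t\<bar>)\<^sup>2 + pi\<^sup>2)))"
    by (simp add: right_diff_distrib mult.commute mult.left_commute)
  finally show ?thesis
    unfolding \<theta>_def A_def .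
qed

end
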